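(* Let $q\in\mathbb{C}$ with $|q|<1$. Then $$\sum_{n=0}^{\infty}\frac{q^{2n^2}(q;q^2)_{n}}{(-q;q^2)_{n}(q^4;q^4)_{n}} =\frac{(q^3;q^6)_{\infty}^{2}(q^6;q^6)_{\infty}}{(q^2;q^2)_{\infty}}.$$
   Context: For $|q|<1$, $x\in\mathbb{C}$ and an integer $n\ge 0$: $(x;q)_n=\prod_{j=0}^{n-1}(1-xq^j)$ (so $(x;q)_0=1$) and $(x;q)_\infty=\prod_{j=0}^{\infty}(1-xq^j)$. The same notation is used with base $q^m$ in place of $q$. *)

theory Defs
  imports "HOL-Analysis.Analysis"
begin

definition qpoch :: "complex \<Rightarrow> complex \<Rightarrow> nat \<Rightarrow> complex"
  where "qpoch x q n = (\<Prod>j<n. 1 - x * q ^ j)"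

(* Meant for norm q < 1, where the product converges for every x
   (to 0 if some factor vanishes, by the convention of has_prod). *)
definition qpoch_inf :: "complex \<Rightarrow> complex \<Rightarrow> complex"
  where "qpoch_inf x q = (\<Prod>j. 1 - x * q ^ j)"

end

theory Submission
  imports Defs
begin

text \<open>
  In base \<open>p = q\<^sup>2\<close> the summand is \<open>p\<^bsup>n\<^sup>2\<^esup> \<beta>\<^sub>n\<close>, where \<open>\<beta>\<close> is paired, in the sense of Bailey relative to \<open>1\<close>,
  with the coefficients \<open>\<alpha>\<^sub>0 = 1\<close>, \<open>\<alpha>\<^sub>r = 2 (-1)\<^bsup>r\<^esup> q\<^bsup>r\<^sup>2\<^esup>\<close> of the theta series \<open>\<Sum>\<^sub>r (-1)\<^bsup>r\<^esup> q\<^bsup>r\<^sup>2\<^esup>\<close>: this is the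
  finite Jacobi triple product at \<open>z = 1\<close>. The finite form of Bailey's lemma turns
  \<open>\<Sum>\<^sub>n p\<^bsup>n\<^sup>2\<^esup> \<beta>\<^sub>n / (p;p)\<^bsub>N-n\<^esub>\<close> into \<open>\<Sum>\<^sub>r p\<^bsup>r\<^sup>2\<^esup> \<alpha>\<^sub>r / ((p;p)\<^bsub>N-r\<^esub> (p;p)\<^bsub>N+r\<^esub>)\<close>. Since \<open>p\<^bsup>r\<^sup>2\<^esup> \<alpha>\<^sub>r\<close> is \<open>\<alpha>\<^sub>r\<close> with \<open>q\<^sup>3\<close> in
  place of \<open>q\<close>, letting \<open>N\<close> tend to infinity gives the theta series in \<open>q\<^sup>3\<close>, whose product form is
  in turn the limit of the finite triple product.
\<close>

section \<open>Convergence, nonvanishing and splitting of q-Pochhammer products\<close>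

lemma qpoch_0 [simp]: "qpoch x q 0 = 1"
  by (simp add: qpoch_def)

lemma qpoch_Suc: "qpoch x q (Suc n) = qpoch x q n * (1 - x * q ^ n)"
  by (simp add: qpoch_def)

lemma one_minus_power_nonzero:
  fixes p :: complex
  assumes "norm p < 1"
  shows "1 - p ^ Suc n \<noteq> 0"
proof
  assume "1 - p ^ Suc n = 0"
  then have "norm (p ^ Suc n) = 1" by (metis eq_iff_diff_eq_0 norm_one)
  then show False
    using assms power_decreasing[of 1 "Suc n" "norm p"] by (simp add: norm_power norm_mult)
qed

lemma qpoch_self_nonzero: "norm p < 1 \<Longrightarrow> qpoch p p n \<noteq> 0"
  using one_minus_power_nonzero[of p] by (simp add: qpoch_def)

lemma qpoch_abs_convergent:
  fixes q :: complex
  assumes "norm q < 1"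
  shows "abs_convergent_prod (\<lambda>j. 1 - x * q ^ j)"
  unfolding abs_convergent_prod_conv_summable
  using assms by (simp add: norm_mult norm_power summable_mult summable_geometric)

lemma qpoch_tendsto:
  assumes "norm q < 1"
  shows "qpoch x q \<longlonglongrightarrow> qpoch_inf x q"
proof -
  have "(\<lambda>n. qpoch x q (Suc n)) \<longlonglongrightarrow> qpoch_inf x q"
    using convergent_prod_LIMSEQ[OF abs_convergent_prod_imp_convergent_prod[OF qpoch_abs_convergent[OF assms, of x]]]
    by (simp add: qpoch_def qpoch_inf_def lessThan_Suc_atMost)
  then show ?thesis by (simp add: filterlim_sequentially_Suc)
qed

lemma qpoch_inf_self_nonzero:
  assumes "norm p < 1"
  shows "qpoch_inf p p \<noteq> 0"
  unfolding qpoch_inf_def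
  by (rule prodinf_nonzero
      [OF abs_convergent_prod_imp_convergent_prod[OF qpoch_abs_convergent[OF assms, of p]]])
    (use one_minus_power_nonzero[OF assms] in simp)

lemma bounded_qpoch:
  assumes "norm q < 1"
  obtains C where "\<And>n. norm (qpoch x q n) \<le> C"
  using convergent_imp_Bseq[OF convergentI[OF qpoch_tendsto[OF assms]]]
  unfolding Bseq_def by blast

lemma inverse_qpoch_self_tendsto:
  assumes "norm p < 1"
  shows "(\<lambda>n. inverse (qpoch p p n)) \<longlonglongrightarrow> inverse (qpoch_inf p p)"
  by (intro tendsto_inverse qpoch_tendsto qpoch_inf_self_nonzero assms)

lemma bounded_inverse_qpoch_self:
  assumes "norm p < 1"
  obtains C where "\<And>n. norm (inverse (qpoch p p n)) \<le> C"
  using convergent_imp_Bseq[OF convergentI[OF inverse_qpoch_self_tendsto[OF assms]]]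
  unfolding Bseq_def by blast

text \<open>The factors \<open>1 - q^(2*i)\<close> with \<open>i\<close> even make up
  \<open>(q^4;q^4)_n\<close>; those with \<open>i\<close> odd split as differences of squares. This
  makes \<open>(q^2;q^2)_(2n)\<close> the denominator of the summand.\<close>

lemma qpoch_square_split:
  "qpoch (q ^ 2) (q ^ 2) (2 * n) = qpoch q (q ^ 2) n * qpoch (- q) (q ^ 2) n * qpoch (q ^ 4) (q ^ 4) n"
proof (induction n)
  case (Suc n)
  have "qpoch (q ^ 2) (q ^ 2) (2 * Suc n)
      = qpoch (q ^ 2) (q ^ 2) (2 * n) * (1 - q ^ (2 + 4 * n)) * (1 - q ^ (4 + 4 * n))"
    by (simp add: qpoch_Suc power_add power_mult power2_eq_square power4_eq_xxxx power_mult_distrib mult.assoc)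
  moreover have "1 - q ^ (2 + 4 * n) = (1 - q * (q ^ 2) ^ n) * (1 - (- q) * (q ^ 2) ^ n)"
    by (simp add: algebra_simps power_add power_mult power2_eq_square power4_eq_xxxx power_mult_distrib)
  moreover have "1 - q ^ (4 + 4 * n) = 1 - q ^ 4 * (q ^ 4) ^ n"
    by (simp add: power_add power_mult)
  ultimately show ?case
    unfolding qpoch_Suc[of q] qpoch_Suc[of "- q"] qpoch_Suc[of "q ^ 4"] Suc.IH
    by (simp only: mult.assoc mult.commute mult.left_commute)
qed simp


section \<open>Finite identities\<close>

text \<open>
  The q-Pascal rule, applied inside a sum weighted by
  \<open>1 / ((p;p)\<^sub>j (p;p)\<^bsub>n-j\<^esub>)\<close>, the q-binomial coefficient divided by \<open>(p;p)\<^sub>n\<close>.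
\<close>

lemma qbinomial_sum_Suc:
  assumes p: "norm p < 1"
  shows "(1 - p ^ Suc n) * (\<Sum>j\<le>Suc n. c j / (qpoch p p j * qpoch p p (Suc n - j)))
       = (\<Sum>j\<le>n. (c j + p ^ (n - j) * c (Suc j)) / (qpoch p p j * qpoch p p (n - j)))"
proof -
  let ?P = "qpoch p p"
  have nz: "?P m \<noteq> 0" "1 - p * p ^ m \<noteq> 0" for m
    using qpoch_self_nonzero[OF p] one_minus_power_nonzero[OF p, of m] by auto
  \<comment> \<open>With \<open>s = Suc n - j\<close>, the split is
    \<open>1 - p^(Suc n) = (1 - p^s) + p^s * (1 - p^j)\<close>. Each bracket cancels the last factor
    of one Pochhammer symbol and kills one boundary term: \<open>j = Suc n\<close> in the first sum,
    \<open>j = 0\<close> in the second.\<close>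
  have "(1 - p ^ Suc n) * (\<Sum>j\<le>Suc n. c j / (?P j * ?P (Suc n - j)))
      = (\<Sum>j\<le>Suc n. (1 - p ^ (Suc n - j)) * c j / (?P j * ?P (Suc n - j)))
      + (\<Sum>j\<le>Suc n. p ^ (Suc n - j) * (1 - p ^ j) * c j / (?P j * ?P (Suc n - j)))"
    unfolding sum_distrib_left sum.distrib [symmetric]
  proof (rule sum.cong)
    fix j assume "j \<in> {..Suc n}"
    then have "p ^ Suc n = p ^ (Suc n - j) * p ^ j" by (simp flip: power_add)
    then show "(1 - p ^ Suc n) * (c j / (?P j * ?P (Suc n - j))) =
       (1 - p ^ (Suc n - j)) * c j / (?P j * ?P (Suc n - j)) +
       p ^ (Suc n - j) * (1 - p ^ j) * c j / (?P j * ?P (Suc n - j))"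
      by (simp only: add_divide_distrib [symmetric] times_divide_eq_right) (simp add: algebra_simps)
  qed simp
  also have "(\<Sum>j\<le>Suc n. (1 - p ^ (Suc n - j)) * c j / (?P j * ?P (Suc n - j)))
      = (\<Sum>j\<le>n. c j / (?P j * ?P (n - j)))"
    using nz by (auto intro!: sum.cong simp: Suc_diff_le qpoch_Suc field_simps)
  also have "(\<Sum>j\<le>Suc n. p ^ (Suc n - j) * (1 - p ^ j) * c j / (?P j * ?P (Suc n - j)))
      = (\<Sum>j\<le>n. p ^ (n - j) * c (Suc j) / (?P j * ?P (n - j)))"
    unfolding sum.atMost_Suc_shift using nz by (auto intro!: sum.cong simp: qpoch_Suc)
  finally show ?thesis by (simp add: sum.distrib add_divide_distrib)
qed

text \<open>The other q-Pascal rule, obtained by reversing the order of summation before and after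
  using the first.\<close>

lemma qbinomial_sum_Suc':
  assumes p: "norm p < 1"
  shows "(1 - p ^ Suc n) * (\<Sum>j\<le>Suc n. c j / (qpoch p p j * qpoch p p (Suc n - j)))
       = (\<Sum>j\<le>n. (p ^ j * c j + c (Suc j)) / (qpoch p p j * qpoch p p (n - j)))"
proof -
  let ?P = "qpoch p p"
  have "(\<Sum>j\<le>Suc n. c j / (?P j * ?P (Suc n - j)))
      = (\<Sum>j\<le>Suc n. c (Suc n - j) / (?P j * ?P (Suc n - j)))"
    by (subst sum.nat_diff_reindex[where n = "Suc (Suc n)", unfolded lessThan_Suc_atMost, symmetric])
       (auto intro!: sum.cong simp: mult.commute)
  then have "(1 - p ^ Suc n) * (\<Sum>j\<le>Suc n. c j / (?P j * ?P (Suc n - j)))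
      = (\<Sum>j\<le>n. (c (Suc n - j) + p ^ (n - j) * c (Suc n - Suc j)) / (?P j * ?P (n - j)))"
    by (simp only: qbinomial_sum_Suc[OF p])
  also have "\<dots> = (\<Sum>j\<le>n. (p ^ j * c j + c (Suc j)) / (?P j * ?P (n - j)))"
    by (subst sum.nat_diff_reindex[where n = "Suc n", unfolded lessThan_Suc_atMost, symmetric])
       (auto intro!: sum.cong simp: mult.commute add.commute Suc_diff_le)
  finally show ?thesis .
qed

text \<open>A form of the q-Vandermonde sum.\<close>

lemma durfee_sum:
  assumes p: "norm p < 1"
  shows "(\<Sum>m\<le>M. p ^ (m * (m + k)) / qpoch p p (m + k) / (qpoch p p m * qpoch p p (M - m)))
       = 1 / (qpoch p p M * qpoch p p (M + k))"
proof (induction M arbitrary: k)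
  case (Suc M)
  let ?P = "qpoch p p"
  have nz: "?P m \<noteq> 0" "1 - p * p ^ m \<noteq> 0" for m
    using qpoch_self_nonzero[OF p] one_minus_power_nonzero[OF p, of m] by auto
  define c where "c m = p ^ (m * (m + k)) / ?P (m + k)" for m
  \<comment> \<open>The two terms carry the weights \<open>1 - p^(m+k+1)\<close> and
    \<open>p^(m+k+1)\<close>, which add up to 1. Lowering \<open>M\<close> thus raises
    \<open>k\<close>, so the induction needs \<open>k\<close> arbitrary.\<close>
  have c: "p ^ m * c m + c (Suc m) = p ^ (m * (m + Suc k)) / ?P (m + Suc k)" for m
  proof -
    have "p ^ m * c m = p ^ (m * (m + Suc k)) * (1 - p ^ Suc (m + k)) / ?P (m + Suc k)"
      using nz(2)[of "m + k"] by (simp add: c_def qpoch_Suc power_add [symmetric] add.commute)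
    moreover have "c (Suc m) = p ^ (m * (m + Suc k)) * p ^ Suc (m + k) / ?P (m + Suc k)"
      unfolding c_def power_add [symmetric] by (simp add: algebra_simps)
    ultimately show ?thesis
      by (simp only: add_divide_distrib [symmetric]) (simp add: algebra_simps)
  qed
  have "(1 - p ^ Suc M) * (\<Sum>m\<le>Suc M. c m / (?P m * ?P (Suc M - m)))
      = 1 / (?P M * ?P (M + Suc k))"
    unfolding qbinomial_sum_Suc'[OF p] c by (rule Suc.IH)
  then have "(\<Sum>m\<le>Suc M. c m / (?P m * ?P (Suc M - m)))
      = 1 / (?P M * ?P (M + Suc k)) / (1 - p ^ Suc M)"
    using nz(2)[of M] by (metis mult.commute nonzero_eq_divide_eq power_Suc)
  then show ?case
    by (simp add: c_def qpoch_Suc mult_ac del: sum.atMost_Suc)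
qed simp

text \<open>After interchanging the sums and putting \<open>n = m + r\<close>, the identity
  \<open>(m+r)^2 = r^2 + m*(m+2*r)\<close> turns the inner sum into \<open>durfee_sum\<close> with
  \<open>M = N - r\<close> and \<open>k = 2*r\<close>.\<close>

lemma finite_bailey_lemma:
  assumes p: "norm p < 1"
  assumes \<beta>: "\<And>n. \<beta> n = (\<Sum>r\<le>n. \<alpha> r / (qpoch p p (n - r) * qpoch p p (n + r)))"
  shows "(\<Sum>n\<le>N. p ^ (n ^ 2) * \<beta> n / qpoch p p (N - n))
       = (\<Sum>r\<le>N. p ^ (r ^ 2) * \<alpha> r / (qpoch p p (N - r) * qpoch p p (N + r)))"
proof -
  let ?P = "qpoch p p"
  define g where
    "g n r = p ^ (n ^ 2) * \<alpha> r / (?P (n - r) * ?P (n + r) * ?P (N - n))" for n r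
  have "(\<Sum>n\<le>N. p ^ (n ^ 2) * \<beta> n / ?P (N - n)) = (\<Sum>n\<le>N. \<Sum>r\<le>n. g n r)"
    by (simp add: \<beta> g_def sum_distrib_left sum_divide_distrib)
  also have "\<dots> = (\<Sum>r\<le>N. \<Sum>n\<in>{r..N}. g n r)"
    by (simp add: sum.Sigma, rule sum.reindex_bij_witness[of _ "\<lambda>(r, n). (n, r)" "\<lambda>(n, r). (r, n)"]) auto
  also have "\<dots> = (\<Sum>r\<le>N. p ^ (r ^ 2) * \<alpha> r / (?P (N - r) * ?P (N + r)))"
  proof (rule sum.cong)
    fix r assume r: "r \<in> {..N}"
    have "(\<Sum>n\<in>{r..N}. g n r) = (\<Sum>m\<le>N - r. g (m + r) r)"
      using r by (intro sum.reindex_bij_witness[of _ "\<lambda>m. m + r" "\<lambda>n. n - r"]) auto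
    also have "\<dots> = p ^ (r ^ 2) * \<alpha> r *
        (\<Sum>m\<le>N - r. p ^ (m * (m + 2 * r)) / ?P (m + 2 * r) / (?P m * ?P (N - r - m)))"
      unfolding sum_distrib_left
    proof (rule sum.cong)
      fix m
      have "(m + r) ^ 2 = r ^ 2 + m * (m + 2 * r)" "N - (m + r) = N - r - m" "m + r + r = m + 2 * r"
        by (auto simp: power2_eq_square algebra_simps)
      then show "g (m + r) r = p ^ (r ^ 2) * \<alpha> r *
          (p ^ (m * (m + 2 * r)) / ?P (m + 2 * r) / (?P m * ?P (N - r - m)))"
        unfolding g_def by (simp only: power_add add_diff_cancel_right') (simp add: ac_simps)
    qed simp
    also have "\<dots> = p ^ (r ^ 2) * \<alpha> r / (?P (N - r) * ?P (N + r))"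
      using r unfolding durfee_sum[OF p] by (simp add: add.commute)
    finally show "(\<Sum>n\<in>{r..N}. g n r) = p ^ (r ^ 2) * \<alpha> r / (?P (N - r) * ?P (N + r))" .
  qed simp
  finally show ?thesis .
qed

text \<open>The finite Jacobi triple product at \<open>z = 1\<close>, with the summation index shifted by \<open>a\<close>.\<close>

lemma finite_triple_product_shifted:
  assumes q: "norm q < 1"
  shows "(\<Sum>j\<le>a + b. (- 1) ^ j * q ^ nat ((int j - int a) ^ 2)
            / (qpoch (q ^ 2) (q ^ 2) j * qpoch (q ^ 2) (q ^ 2) (a + b - j)))
       = (- 1) ^ a * qpoch q (q ^ 2) a * qpoch q (q ^ 2) b / qpoch (q ^ 2) (q ^ 2) (a + b)"
proof -
  define p where "p = q ^ 2"
  have p: "norm p < 1"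
    using q by (simp add: p_def norm_power power_less_one_iff)
  let ?P = "qpoch p p" and ?Q = "qpoch q p"
  have nz: "?P m \<noteq> 0" "1 - p * p ^ m \<noteq> 0" for m
    using qpoch_self_nonzero[OF p] one_minus_power_nonzero[OF p, of m] by auto
  define T where "T a b = (\<Sum>j\<le>a + b. (- 1) ^ j * q ^ nat ((int j - int a) ^ 2)
      / (?P j * ?P (a + b - j)))" for a b
  have T_Suc: "(1 - p ^ Suc (a + b)) * T a (Suc b) = (1 - q * p ^ b) * T a b" for a b
  proof -
    define c where "c j = (- 1) ^ j * q ^ nat ((int j - int a) ^ 2)" for j
    have "c j + p ^ (a + b - j) * c (Suc j) = (1 - q * p ^ b) * c j" if "j \<le> a + b" for j
    proof -
      \<comment> \<open>Comparing exponents of \<open>q\<close>: both terms of the Pascal rule are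
        multiples of \<open>c j\<close>, with ratio \<open>-q^(2*b+1)\<close> independent of
        \<open>j\<close>. The integers avoid truncation of \<open>j - a\<close>.\<close>
      have "int (2 * (a + b - j) + nat ((int (Suc j) - int a) ^ 2))
          = int (1 + 2 * b + nat ((int j - int a) ^ 2))"
        using that by (simp only: of_nat_add of_nat_mult of_nat_diff of_nat_Suc int_nat_eq
            zero_le_power2 if_True) (simp add: power2_eq_square algebra_simps)
      then have "2 * (a + b - j) + nat ((int (Suc j) - int a) ^ 2)
          = 1 + 2 * b + nat ((int j - int a) ^ 2)"
        by (simp only: of_nat_eq_iff)
      then have "p ^ (a + b - j) * q ^ nat ((int (Suc j) - int a) ^ 2)
          = q * p ^ b * q ^ nat ((int j - int a) ^ 2)"
        unfolding p_def power_mult [symmetric] by (metis power_add power_one_right)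
      then show ?thesis by (simp add: c_def algebra_simps)
    qed
    then show ?thesis
      using qbinomial_sum_Suc[OF p, of "a + b" c]
      by (simp add: T_def c_def sum_distrib_left del: sum.atMost_Suc)
  qed
  have step: "T a b = ?Q b * ?P a / ?P (a + b) * T a 0" for a b
  proof (induction b)
    case (Suc b)
    have "T a (Suc b) = (1 - q * p ^ b) * T a b / (1 - p * p ^ (a + b))"
      using T_Suc[of a b] nz(2)[of "a + b"] by (simp add: field_simps)
    then show ?case using Suc.IH by (simp add: qpoch_Suc)
  qed (use nz in simp)
  \<comment> \<open>The recursion moves only \<open>b\<close>; reversing the sum trades
    \<open>T a 0\<close> for \<open>T 0 a\<close>, which the recursion evaluates from
    \<open>T 0 0 = 1\<close>.\<close>
  have sym: "T a 0 = (- 1) ^ a * T 0 a" for a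
  proof -
    have "T a 0 = (\<Sum>j\<le>a. (- 1) ^ (a - j) * q ^ nat ((int (a - j) - int a) ^ 2)
        / (?P (a - j) * ?P j))"
      unfolding T_def
      by (subst sum.nat_diff_reindex[where n = "Suc a", unfolded lessThan_Suc_atMost, symmetric])
         (auto intro!: sum.cong)
    also have "\<dots> = (- 1) ^ a * T 0 a"
      unfolding T_def sum_distrib_left
      by (auto intro!: sum.cong simp: of_nat_diff power_add mult.commute
          simp flip: neg_one_power_add_eq_neg_one_power_diff)
    finally show ?thesis .
  qed
  have "T 0 a = ?Q a / ?P a"
    using step[of 0 a] by (simp add: T_def)
  then have "T a b = (- 1) ^ a * ?Q a * ?Q b / ?P (a + b)"
    using step[of a b] nz by (simp add: sym)
  then show ?thesis by (simp add: T_def p_def)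
qed

text \<open>Folds a sum about its middle index; the induction peels off both ends.\<close>

lemma sum_atMost_double:
  fixes f :: "nat \<Rightarrow> 'a::comm_monoid_add"
  shows "(\<Sum>j\<le>2 * n. f j) = (\<Sum>r\<le>n. if r = 0 then f n else f (n - r) + f (n + r))"
proof (induction n arbitrary: f)
  case (Suc n)
  have "(\<Sum>j\<le>2 * Suc n. f j) = (\<Sum>j\<le>2 * n. f (Suc j)) + (f 0 + f (2 * Suc n))"
    unfolding mult_Suc_right add_2_eq_Suc sum.atMost_Suc[of f "Suc (2 * n)"]
      sum.atMost_Suc_shift[of f "2 * n"]
    by (simp only: ac_simps)
  also have "(\<Sum>j\<le>2 * n. f (Suc j))
      = (\<Sum>r\<le>n. if r = 0 then f (Suc n) else f (Suc n - r) + f (Suc n + r))"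
    unfolding Suc.IH by (auto intro!: sum.cong simp: Suc_diff_le)
  finally show ?case by (simp add: mult_2)
qed simp

text \<open>The bilateral coefficients \<open>(-1)^r * q^(r^2)\<close> folded onto
  \<open>r \<ge> 0\<close>: the terms at \<open>r\<close> and \<open>-r\<close> agree, hence the
  2.\<close>

definition theta_coeff :: "complex \<Rightarrow> nat \<Rightarrow> complex"
  where "theta_coeff q r = (if r = 0 then 1 else 2 * (- 1) ^ r * q ^ (r ^ 2))"

lemma theta_coeff_cube: "(q ^ 2) ^ (r ^ 2) * theta_coeff q r = theta_coeff (q ^ 3) r"
  by (simp add: theta_coeff_def power_mult [symmetric] power_add [symmetric])

text \<open>The case \<open>a = b = n\<close> folded about the centre. It serves twice: as the
  Bailey pair, and as the finite form of the product for the theta series.\<close>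

lemma finite_triple_product:
  assumes q: "norm q < 1"
  shows "(\<Sum>r\<le>n. theta_coeff q r / (qpoch (q ^ 2) (q ^ 2) (n - r) * qpoch (q ^ 2) (q ^ 2) (n + r)))
       = qpoch q (q ^ 2) n ^ 2 / qpoch (q ^ 2) (q ^ 2) (2 * n)"
proof -
  let ?P = "qpoch (q ^ 2) (q ^ 2)"
  define f where "f j = (- 1) ^ j * q ^ nat ((int j - int n) ^ 2) / (?P j * ?P (2 * n - j))" for j
  have "(if r = 0 then f n else f (n - r) + f (n + r))
      = (- 1) ^ n * (theta_coeff q r / (?P (n - r) * ?P (n + r)))" if "r \<le> n" for r
  proof -
    have "2 * n - (n + r) = n - r" "2 * n - (n - r) = n + r" "2 * n - n = n"
      using that by auto
    moreover have "nat (int r ^ 2) = r ^ 2"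
      by (simp add: nat_power_eq)
    moreover have "(- 1 :: complex) ^ (n - r) = (- 1) ^ n * (- 1) ^ r"
      using that by (metis neg_one_power_add_eq_neg_one_power_diff power_add)
    ultimately show ?thesis
      using that by (simp add: f_def theta_coeff_def of_nat_diff power_add field_simps)
  qed
  then have "(\<Sum>j\<le>2 * n. f j)
      = (- 1) ^ n * (\<Sum>r\<le>n. theta_coeff q r / (?P (n - r) * ?P (n + r)))"
    unfolding sum_atMost_double sum_distrib_left by (intro sum.cong) auto
  moreover have "(\<Sum>j\<le>2 * n. f j) = (- 1) ^ n * (qpoch q (q ^ 2) n ^ 2 / ?P (2 * n))"
    using finite_triple_product_shifted[OF q, of n n]
    by (simp add: f_def mult_2 power2_eq_square mult.assoc)
  ultimately have "(- 1) ^ n * (\<Sum>r\<le>n. theta_coeff q r / (?P (n - r) * ?P (n + r)))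
      = (- 1) ^ n * (qpoch q (q ^ 2) n ^ 2 / ?P (2 * n))"
    by (rule trans[OF sym])
  then show ?thesis by (subst (asm) mult_left_cancel) simp_all
qed


section \<open>Limits\<close>

text \<open>Tannery's theorem with dominating series \<open>norm (a r) * C\<close>, after extending
  the partial sums by zero. The limit \<open>L\<close> is common to all \<open>r\<close> and factors
  out.\<close>

lemma tendsto_weighted_partial_sums:
  fixes a :: "nat \<Rightarrow> complex"
  assumes a: "summable (\<lambda>r. norm (a r))"
  assumes w: "\<And>r. (\<lambda>N. w N r) \<longlonglongrightarrow> L"
  assumes C: "\<And>N r. norm (w N r) \<le> C"
  shows "(\<lambda>N. \<Sum>r\<le>N. a r * w N r) \<longlonglongrightarrow> suminf a * L"
proof -
  define g where "g r N = (if r \<le> N then a r * w N r else 0)" for r N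
  have "((\<lambda>N. suminf (\<lambda>r. g r N)) \<longlongrightarrow> suminf (\<lambda>r. a r * L)) sequentially"
  proof (rule conjunct2[OF conjunct2[OF tannerys_theorem[where M = "\<lambda>r. norm (a r) * C"]]])
    fix r
    have "(\<lambda>N. a r * w N r) \<longlonglongrightarrow> a r * L"
      by (intro tendsto_intros w)
    then show "(\<lambda>N. g r N) \<longlonglongrightarrow> a r * L"
      by (rule Lim_transform_eventually)
         (auto simp: g_def intro!: eventually_mono[OF eventually_ge_at_top[of r]])
  next
    have "0 \<le> C" using C[of 0 0] norm_ge_zero order_trans by blast
    then have "norm (g r N) \<le> norm (a r) * C" for r N
      using C by (auto simp: g_def norm_mult intro!: mult_left_mono)
    then show "\<forall>\<^sub>F (r, N) in at_top \<times>\<^sub>F sequentially. norm (g r N) \<le> norm (a r) * C"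
      by (intro always_eventually) auto
  next
    show "summable (\<lambda>r. norm (a r) * C)" using a by (rule summable_mult2)
  qed simp
  moreover have "suminf (\<lambda>r. g r N) = (\<Sum>r\<le>N. a r * w N r)" for N
    by (subst suminf_finite[of "{..N}"]) (auto simp: g_def)
  moreover have "suminf (\<lambda>r. a r * L) = suminf a * L"
    using suminf_mult2[OF summable_norm_cancel[OF a]] by simp
  ultimately show ?thesis by simp
qed

lemma filterlim_diff_const_at_top: "filterlim (\<lambda>n::nat. n - k) at_top at_top"
  unfolding filterlim_at_top eventually_at_top_linorder by (metis le_diff_conv2 add_leD2)

lemma tendsto_symmetric_weighted_sums:
  assumes p: "norm p < 1" and a: "summable (\<lambda>r. norm (a r))"
  shows "(\<lambda>N. \<Sum>r\<le>N. a r / (qpoch p p (N - r) * qpoch p p (N + r)))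
           \<longlonglongrightarrow> suminf a / qpoch_inf p p ^ 2"
proof -
  let ?I = "\<lambda>n. inverse (qpoch p p n)"
  obtain C where C: "\<And>n. norm (?I n) \<le> C"
    using bounded_inverse_qpoch_self[OF p] by blast
  have "0 \<le> C" using C[of 0] norm_ge_zero order_trans by blast
  note lim = inverse_qpoch_self_tendsto[OF p]
  have "(\<lambda>N. \<Sum>r\<le>N. a r * (?I (N - r) * ?I (N + r)))
      \<longlonglongrightarrow> suminf a * (inverse (qpoch_inf p p) * inverse (qpoch_inf p p))"
  proof (rule tendsto_weighted_partial_sums[OF a])
    show "(\<lambda>N. ?I (N - r) * ?I (N + r)) \<longlonglongrightarrow> inverse (qpoch_inf p p) * inverse (qpoch_inf p p)" for r
      by (intro tendsto_mult filterlim_compose[OF lim filterlim_diff_const_at_top]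
          LIMSEQ_ignore_initial_segment[OF lim])
    \<comment> \<open>\<open>C\<close> bounds the inverse at every index, so truncation of
      \<open>N - r\<close> for \<open>r > N\<close> does no harm.\<close>
    show "norm (?I (N - r) * ?I (N + r)) \<le> C * C" for N r
      unfolding norm_mult by (intro mult_mono C norm_ge_zero \<open>0 \<le> C\<close>)
  qed
  then show ?thesis by (simp add: divide_inverse power2_eq_square)
qed

lemma summable_power_square:
  fixes x :: "'a::real_normed_div_algebra"
  assumes "norm x < 1"
  shows "summable (\<lambda>n. norm (x ^ (n ^ 2)))"
proof (rule summable_comparison_test')
  show "summable (\<lambda>n. norm x ^ n)" using assms by (simp add: summable_geometric)
  show "norm (norm (x ^ (n ^ 2))) \<le> norm x ^ n" for n
    using assms by (auto simp: norm_power power2_eq_square intro!: power_decreasing le_square)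
qed

lemma summable_theta_coeff:
  assumes "norm q < 1"
  shows "summable (\<lambda>r. norm (theta_coeff q r))"
proof (rule summable_comparison_test')
  show "summable (\<lambda>r. 2 * norm (q ^ (r ^ 2)))"
    by (intro summable_mult summable_power_square assms)
qed (auto simp: theta_coeff_def norm_mult norm_power)

text \<open>Gauss's product formula: the two sides of \<open>finite_triple_product\<close> have
  limits with denominators \<open>(q^2;q^2)_inf\<close> squared and to the first power, so one such
  factor survives.\<close>

lemma suminf_theta_coeff:
  assumes q: "norm q < 1"
  shows "suminf (theta_coeff q) = qpoch_inf q (q ^ 2) ^ 2 * qpoch_inf (q ^ 2) (q ^ 2)"
proof -
  let ?p = "q ^ 2"
  have p: "norm ?p < 1"
    using q by (simp add: norm_power power_less_one_iff)
  have nz: "qpoch_inf ?p ?p \<noteq> 0" by (rule qpoch_inf_self_nonzero[OF p])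
  have "(\<lambda>n. qpoch ?p ?p (2 * n)) \<longlonglongrightarrow> qpoch_inf ?p ?p"
    by (rule filterlim_compose[OF qpoch_tendsto[OF p]])
       (auto intro!: filterlim_at_top_mono[OF filterlim_ident])
  then have "(\<lambda>n. qpoch q ?p n ^ 2 / qpoch ?p ?p (2 * n)) \<longlonglongrightarrow> qpoch_inf q ?p ^ 2 / qpoch_inf ?p ?p"
    by (intro tendsto_intros qpoch_tendsto p nz)
  moreover have "(\<lambda>n. qpoch q ?p n ^ 2 / qpoch ?p ?p (2 * n))
      \<longlonglongrightarrow> suminf (theta_coeff q) / qpoch_inf ?p ?p ^ 2"
    using tendsto_symmetric_weighted_sums[OF p summable_theta_coeff[OF q]]
    by (simp add: finite_triple_product[OF q])
  ultimately have "qpoch_inf q ?p ^ 2 / qpoch_inf ?p ?p = suminf (theta_coeff q) / qpoch_inf ?p ?p ^ 2"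
    by (rule LIMSEQ_unique)
  then show ?thesis using nz by (simp add: field_simps power2_eq_square)
qed

theorem theorem2p4:
  fixes q :: complex
  assumes "norm q < 1"
  shows "(\<lambda>n. q ^ (2 * n ^ 2) * qpoch q (q ^ 2) n
                / (qpoch (- q) (q ^ 2) n * qpoch (q ^ 4) (q ^ 4) n))
         sums ((qpoch_inf (q ^ 3) (q ^ 6)) ^ 2 * qpoch_inf (q ^ 6) (q ^ 6)
                / qpoch_inf (q ^ 2) (q ^ 2))"
proof -
  define p where "p = q ^ 2"
  have p: "norm p < 1" and q3: "norm (q ^ 3) < 1"
    using assms by (auto simp: p_def norm_power power_less_one_iff)
  let ?P = "qpoch p p" and ?P_inf = "qpoch_inf p p" and ?Q = "qpoch q p"
  have nz: "?P_inf \<noteq> 0" by (rule qpoch_inf_self_nonzero[OF p])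
  define \<beta> where "\<beta> n = ?Q n ^ 2 / ?P (2 * n)" for n
  define t where "t n = p ^ (n ^ 2) * \<beta> n" for n
  \<comment> \<open>Expanding the fraction by \<open>(q;q^2)_n\<close> makes its denominator
    \<open>(p;p)_(2n)\<close>; as this is nonzero, so is each of its three factors.\<close>
  have t_eq: "q ^ (2 * n ^ 2) * qpoch q (q ^ 2) n
      / (qpoch (- q) (q ^ 2) n * qpoch (q ^ 4) (q ^ 4) n) = t n" for n
    using qpoch_square_split[of q n] qpoch_self_nonzero[OF p, of "2 * n"]
    by (simp add: t_def \<beta>_def p_def power_mult power2_eq_square)
  \<comment> \<open>Bounding \<open>\<beta>\<close> uniformly leaves \<open>p^(n^2)\<close> to
    dominate \<open>t\<close>.\<close>
  obtain A where A: "\<And>n. norm (?Q n) \<le> A" using bounded_qpoch[OF p, of q] by blast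
  obtain C where C: "\<And>n. norm (inverse (?P n)) \<le> C"
    using bounded_inverse_qpoch_self[OF p] by blast
  have "norm (\<beta> n) \<le> A ^ 2 * C" for n
    unfolding \<beta>_def divide_inverse norm_mult norm_power
    by (intro mult_mono power_mono A C norm_ge_zero zero_le_power2)
  then have "norm (norm (t n)) \<le> norm (p ^ (n ^ 2)) * (A ^ 2 * C)" for n
    by (simp add: t_def norm_mult mult_left_mono)
  then have t: "summable (\<lambda>n. norm (t n))"
    by (rule summable_comparison_test'[OF summable_mult2[OF summable_power_square[OF p]]])
  have "(\<lambda>N. \<Sum>n\<le>N. t n * inverse (?P (N - n))) \<longlonglongrightarrow> suminf t * inverse ?P_inf"
    by (rule tendsto_weighted_partial_sums[OF t _ C])
       (rule filterlim_compose[OF inverse_qpoch_self_tendsto[OF p] filterlim_diff_const_at_top])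
  moreover have "(\<Sum>n\<le>N. t n * inverse (?P (N - n)))
      = (\<Sum>r\<le>N. theta_coeff (q ^ 3) r / (?P (N - r) * ?P (N + r)))" for N
    using finite_bailey_lemma[OF p, of \<beta> "theta_coeff q" N] finite_triple_product[OF assms]
    by (simp add: t_def \<beta>_def p_def theta_coeff_cube divide_inverse)
  ultimately have "(\<lambda>N. \<Sum>r\<le>N. theta_coeff (q ^ 3) r / (?P (N - r) * ?P (N + r)))
      \<longlonglongrightarrow> suminf t * inverse ?P_inf"
    by simp
  \<comment> \<open>The theta coefficients now belong to \<open>q^3\<close>, but the weights keep
    the base \<open>p\<close>; hence \<open>(q^2;q^2)_inf\<close> remains below the products in base
    \<open>q^6\<close>.\<close>
  then have "suminf t * inverse ?P_inf = suminf (theta_coeff (q ^ 3)) / ?P_inf ^ 2"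
    using tendsto_symmetric_weighted_sums[OF p summable_theta_coeff[OF q3]] by (rule LIMSEQ_unique)
  then have "suminf t = suminf (theta_coeff (q ^ 3)) / ?P_inf"
    using nz by (simp add: field_simps power2_eq_square)
  then have "suminf t = qpoch_inf (q ^ 3) (q ^ 6) ^ 2 * qpoch_inf (q ^ 6) (q ^ 6) / qpoch_inf (q ^ 2) (q ^ 2)"
    by (simp add: suminf_theta_coeff[OF q3] p_def flip: power_mult)
  then show ?thesis
    unfolding t_eq using summable_sums[OF summable_norm_cancel[OF t]] by simp
qed

end
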